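(* Let $p\equiv 1\pmod 4$ be a prime. (i) For each $a\in V$, letting $b=\overline{a}-a$, we have $b\in V$ and $\overline{b}=\widetilde{\overline{a}+a}$. (ii) $\{\overline{a}-a : a\in V\}=V$ and $\{\widetilde{\overline{a}+a} : a\in V\}=\{1,2,\ldots,(p-1)/2\}\setminus V$.
   Context: For an integer $x$, $\{x\}_p$ denotes the least nonnegative residue of $x$ modulo $p$, and $\widetilde{x}=p-\{x\}_p$ if $\{x\}_p>p/2$, while $\widetilde{x}=\{x\}_p$ if $\{x\}_p<p/2$. Let $t=\prod_{x=1}^{(p-1)/2}x$. Let $V=\{x : 1\le x\le (p-1)/2,\ x<\widetilde{tx}\}$, and for $a\in V$ put $\overline{a}=\widetilde{ta}$. *)

theory Defs
  imports "HOL-Number_Theory.Number_Theory"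
begin

text \<open>
  For an odd modulus \<open>p\<close> the case \<open>2 * (x mod p) = p\<close> does not arise.
\<close>

definition fold_res :: "int \<Rightarrow> int \<Rightarrow> int" where
  "fold_res p x = (if 2 * (x mod p) > p then p - x mod p else x mod p)"

definition half_fact :: "int \<Rightarrow> int" where
  "half_fact p = (\<Prod>x\<in>{1..(p - 1) div 2}. x)"

definition bar :: "int \<Rightarrow> int \<Rightarrow> int" where
  "bar p a = fold_res p (half_fact p * a)"

definition V :: "int \<Rightarrow> int set" where
  "V p = {x. 1 \<le> x \<and> x \<le> (p - 1) div 2 \<and> x < fold_res p (half_fact p * x)}"

end

theory Submission
  imports Defs
begin

text \<open>
  By Wilson's theorem \<open>t = half_fact p\<close> satisfies \<open>t\<^sup>2 \<equiv> -1\<close> modulo \<open>p\<close>, so multiplication by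
  \<open>t\<close> is a quarter turn: up to sign it is an involution without fixed points of
  \<open>{1..(p - 1) div 2}\<close>, and \<open>V p\<close> consists of the smaller elements of its orbits. If
  \<open>A \<equiv> \<plusminus>t a\<close>, then \<open>t (A - a) \<equiv> \<mp>(A + a)\<close>; this gives the first claim. The map
  \<open>a \<mapsto> A - a\<close> on the finite set \<open>V p\<close> is injective, since \<open>A - a\<close> determines \<open>A + a\<close> up to
  replacing it by \<open>p - (A + a)\<close>, and the parity of \<open>A + a\<close>, which is that of \<open>A - a\<close>, decides
  between the two as \<open>p\<close> is odd. Hence it is onto \<open>V p\<close>, and \<open>a \<mapsto> A + a\<close>, up to sign, has the
  same image as the quarter turn, the complement of \<open>V p\<close>.
\<close>

definition half_residues :: "int \<Rightarrow> int set" where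
  "half_residues p = {1..(p - 1) div 2}"

lemma mem_half_residues_iff: "x \<in> half_residues p \<longleftrightarrow> 0 < x \<and> 2 * x < p"
  by (auto simp: half_residues_def)

lemma fold_res_cong_or_cong_minus:
  "[fold_res p x = x] (mod p) \<or> [fold_res p x = - x] (mod p)"
  by (simp add: fold_res_def cong_def mod_simps)

lemma fold_res_cong: "[x = y] (mod p) \<Longrightarrow> fold_res p x = fold_res p y"
  by (simp add: fold_res_def cong_def)

lemma fold_res_minus: "odd p \<Longrightarrow> fold_res p (- x) = fold_res p x"
  by (auto simp: fold_res_def zmod_zminus1_eq_if)

lemma fold_res_eq_iff:
  assumes "odd p"
  shows "fold_res p x = fold_res p y \<longleftrightarrow> [x = y] (mod p) \<or> [x = - y] (mod p)"
proof
  assume eq: "fold_res p x = fold_res p y"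
  from fold_res_cong_or_cong_minus[of p x] fold_res_cong_or_cong_minus[of p y]
  show "[x = y] (mod p) \<or> [x = - y] (mod p)"
    unfolding eq by (metis add.inverse_inverse cong_minus_minus_iff cong_sym cong_trans)
next
  assume "[x = y] (mod p) \<or> [x = - y] (mod p)"
  then show "fold_res p x = fold_res p y"
    using fold_res_cong fold_res_minus[OF assms] by metis
qed

lemma fold_res_of_residue:
  "0 \<le> x \<Longrightarrow> x < p \<Longrightarrow> fold_res p x = (if 2 * x > p then p - x else x)"
  by (simp add: fold_res_def)

lemma fold_res_half_residue: "x \<in> half_residues p \<Longrightarrow> fold_res p x = x"
  by (simp add: mem_half_residues_iff fold_res_of_residue)

lemma fold_res_mem_half_residues:
  assumes "p > 0" "odd p" "\<not> p dvd x"
  shows "fold_res p x \<in> half_residues p"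
proof -
  have "x mod p \<noteq> 0" using assms(3) by (simp add: dvd_eq_mod_eq_0)
  then have "0 < x mod p" "x mod p < p"
    using assms(1) pos_mod_bound[of p x] pos_mod_sign[of p x] by linarith+
  then show ?thesis
    using assms(2) by (auto simp: fold_res_def mem_half_residues_iff elim!: oddE)
qed

lemma fold_res_mult_fold_res:
  assumes "odd p"
  shows "fold_res p (k * fold_res p x) = fold_res p (k * x)"
  unfolding fold_res_eq_iff[OF assms]
  using fold_res_cong_or_cong_minus[of p x] cong_scalar_left[of "fold_res p x" _ p k] by force

lemma fold_res_eq_imp_eq_if_same_parity:
  assumes "odd p" "0 \<le> x" "x < p" "0 \<le> y" "y < p" "even x \<longleftrightarrow> even y"
    and "fold_res p x = fold_res p y"
  shows "x = y"
proof -
  have "x = y \<or> x = p - y"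
    using assms by (simp add: fold_res_of_residue split: if_splits)
  then show ?thesis using assms(1,6) by auto
qed

lemma involution_image_less:
  fixes f :: "'a::linorder \<Rightarrow> 'a"
  assumes "\<And>x. x \<in> S \<Longrightarrow> f x \<in> S" "\<And>x. x \<in> S \<Longrightarrow> f (f x) = x" "\<And>x. x \<in> S \<Longrightarrow> f x \<noteq> x"
  shows "f ` {x \<in> S. x < f x} = S - {x \<in> S. x < f x}"
proof (intro equalityI subsetI)
  fix y assume "y \<in> f ` {x \<in> S. x < f x}"
  then show "y \<in> S - {x \<in> S. x < f x}" using assms(1,2) by auto
next
  fix y assume y: "y \<in> S - {x \<in> S. x < f x}"
  then have "f y \<in> {x \<in> S. x < f x}" using assms[of y] by auto
  then show "y \<in> f ` {x \<in> S. x < f x}" using assms(2)[of y] y by (auto intro: rev_image_eqI)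
qed

locale sqrt_minus_one =
  fixes p t :: int
  assumes odd_modulus: "odd p"
    and square_cong: "[t\<^sup>2 = - 1] (mod p)"
begin

definition quarter_turn :: "int \<Rightarrow> int" where
  "quarter_turn x = fold_res p (t * x)"

definition orbit_minima :: "int set" where
  "orbit_minima = {x \<in> half_residues p. x < quarter_turn x}"

lemma mult_mult_cong_minus: "[t * (t * x) = - x] (mod p)"
  using cong_scalar_right[OF square_cong, of x] by (simp add: power2_eq_square mult.assoc)

lemma quarter_turn_mem:
  assumes "x \<in> half_residues p"
  shows "quarter_turn x \<in> half_residues p"
proof -
  have x: "0 < x" "x < p" using assms by (auto simp: mem_half_residues_iff)
  have "\<not> p dvd t * x"
  proof
    assume "p dvd t * x"
    then have "p dvd t * (t * x)" by simp
    then have "p dvd x" using mult_mult_cong_minus[of x] by (simp add: cong_dvd_iff)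
    then show False using x zdvd_not_zless by blast
  qed
  then show ?thesis
    unfolding quarter_turn_def using x odd_modulus by (intro fold_res_mem_half_residues) auto
qed

lemma quarter_turn_quarter_turn:
  assumes "x \<in> half_residues p"
  shows "quarter_turn (quarter_turn x) = x"
proof -
  have "quarter_turn (quarter_turn x) = fold_res p (t * (t * x))"
    by (simp add: quarter_turn_def fold_res_mult_fold_res odd_modulus)
  also have "\<dots> = fold_res p x"
    using mult_mult_cong_minus odd_modulus by (simp add: fold_res_eq_iff)
  also have "\<dots> = x" using assms by (rule fold_res_half_residue)
  finally show ?thesis .
qed

lemma quarter_turn_diff: "quarter_turn (quarter_turn x - x) = fold_res p (quarter_turn x + x)"
proof -
  define y where "y = quarter_turn x"
  consider (same) "[y = t * x] (mod p)" | (opposite) "[y = - (t * x)] (mod p)"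
    using fold_res_cong_or_cong_minus[of p "t * x"] by (auto simp: y_def quarter_turn_def)
  then have "[t * (y - x) = y + x] (mod p) \<or> [t * (y - x) = - (y + x)] (mod p)"
  proof cases
    case same
    then have "[t * y = - x] (mod p)"
      by (rule cong_trans[OF cong_scalar_left mult_mult_cong_minus])
    then have "[t * y - t * x = - x - y] (mod p)"
      using cong_sym[OF same] by (rule cong_diff)
    then have "[t * (y - x) = - (y + x)] (mod p)"
      by (simp add: right_diff_distrib add.commute[of y])
    then show ?thesis ..
  next
    case opposite
    then have "[- (t * y) = - x] (mod p)"
      using cong_scalar_left[of y _ p "- t"] mult_mult_cong_minus cong_trans by fastforce
    then have "[t * y + - (t * x) = x + y] (mod p)"
      using cong_sym[OF opposite] unfolding cong_minus_minus_iff by (rule cong_add)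
    then have "[t * (y - x) = y + x] (mod p)"
      by (simp add: right_diff_distrib add.commute[of x])
    then show ?thesis ..
  qed
  then show ?thesis
    by (simp add: quarter_turn_def[of "_ - _"] fold_res_eq_iff odd_modulus flip: y_def)
qed

text \<open>A fixed point \<open>x\<close> would give \<open>fold_res p (2 * x) = quarter_turn (x - x) = 0\<close>.\<close>
lemma quarter_turn_neq:
  assumes "x \<in> half_residues p"
  shows "quarter_turn x \<noteq> x"
proof
  assume "quarter_turn x = x"
  then have "quarter_turn 0 = fold_res p (2 * x)"
    using quarter_turn_diff[of x] by simp
  then show False
    using assms by (auto simp: quarter_turn_def fold_res_of_residue mem_half_residues_iff
        split: if_splits)
qed

lemma quarter_turn_image_orbit_minima:
  "quarter_turn ` orbit_minima = half_residues p - orbit_minima"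
  unfolding orbit_minima_def
  by (intro involution_image_less quarter_turn_mem quarter_turn_quarter_turn quarter_turn_neq)

lemma orbit_minima_bounds:
  assumes "x \<in> orbit_minima"
  shows "0 < x" "x < quarter_turn x" "2 * quarter_turn x < p"
  using assms quarter_turn_mem[of x] by (auto simp: orbit_minima_def mem_half_residues_iff)

lemma diff_mem_orbit_minima:
  assumes "x \<in> orbit_minima"
  shows "quarter_turn x - x \<in> orbit_minima"
proof -
  note bounds = orbit_minima_bounds[OF assms]
  then have "quarter_turn x - x < fold_res p (quarter_turn x + x)"
    by (simp add: fold_res_of_residue)
  then show ?thesis
    using bounds by (simp add: orbit_minima_def quarter_turn_diff mem_half_residues_iff)
qed

lemma inj_on_diff_orbit_minima: "inj_on (\<lambda>x. quarter_turn x - x) orbit_minima"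
proof (rule inj_onI)
  fix x y
  assume mem: "x \<in> orbit_minima" "y \<in> orbit_minima"
    and eq: "quarter_turn x - x = quarter_turn y - y"
  have "quarter_turn x + x = quarter_turn y + y"
  proof (rule fold_res_eq_imp_eq_if_same_parity)
    show "fold_res p (quarter_turn x + x) = fold_res p (quarter_turn y + y)"
      using eq by (metis quarter_turn_diff)
    show "even (quarter_turn x + x) \<longleftrightarrow> even (quarter_turn y + y)"
      using eq by presburger
  qed (use odd_modulus orbit_minima_bounds[OF mem(1)] orbit_minima_bounds[OF mem(2)] in auto)
  with eq show "x = y" by simp
qed

lemma diff_image_orbit_minima: "(\<lambda>x. quarter_turn x - x) ` orbit_minima = orbit_minima"
proof (rule endo_inj_surj)
  have "finite (half_residues p)" by (simp add: half_residues_def)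
  then show "finite orbit_minima" by (simp add: orbit_minima_def)
qed (use diff_mem_orbit_minima inj_on_diff_orbit_minima in auto)

lemma sum_image_orbit_minima:
  "(\<lambda>x. fold_res p (quarter_turn x + x)) ` orbit_minima = half_residues p - orbit_minima"
proof -
  have "(\<lambda>x. fold_res p (quarter_turn x + x)) ` orbit_minima
      = quarter_turn ` (\<lambda>x. quarter_turn x - x) ` orbit_minima"
    by (simp add: image_image quarter_turn_diff)
  then show ?thesis
    by (simp add: diff_image_orbit_minima quarter_turn_image_orbit_minima)
qed

end

lemma fact_pred_cong_fact_mult_fact:
  assumes "k < n"
  shows "[fact (n - 1) = (- 1) ^ k * fact k * fact (n - 1 - k)] (mod int n)"
  using assms
proof (induction k)
  case 0
  then show ?case by simp
next
  case (Suc k)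
  have factor_cong: "[int (n - 1 - k) = - int (Suc k)] (mod int n)"
    using Suc.prems by (simp add: cong_iff_dvd_diff)
  define r :: int where "r = fact (n - 1 - Suc k)"
  have "fact (n - 1 - k) = int (n - 1 - k) * r"
    unfolding r_def using Suc.prems by (subst fact_reduce) (simp_all del: of_nat_diff)
  then have "[fact (n - 1) = (- 1) ^ k * fact k * (int (n - 1 - k) * r)] (mod int n)"
    using Suc.IH Suc.prems by simp
  also have "[(- 1) ^ k * fact k * (int (n - 1 - k) * r)
      = (- 1) ^ k * fact k * (- int (Suc k) * r)] (mod int n)"
    by (intro cong_scalar_left cong_scalar_right factor_cong)
  also have "(- 1) ^ k * fact k * (- int (Suc k) * r) = (- 1) ^ Suc k * fact (Suc k) * r"
    by (simp add: algebra_simps)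
  finally show ?case unfolding r_def .
qed

lemma half_fact_eq_fact: "half_fact p = fact (nat ((p - 1) div 2))"
proof -
  have "half_fact p = (\<Prod>i\<in>{1..nat ((p - 1) div 2)}. int i)"
    unfolding half_fact_def by (rule prod.reindex_bij_witness[of _ int nat]) auto
  then show ?thesis by (simp add: fact_prod)
qed

lemma half_fact_square_cong:
  assumes "prime p" "[p = 1] (mod 4)"
  shows "[(half_fact p)\<^sup>2 = - 1] (mod p)"
proof -
  have "p > 1" using assms(1) by (rule prime_gt_1_int)
  have "4 dvd p - 1" using assms(2) by (simp add: cong_iff_dvd_diff)
  then obtain k where "p = 4 * k + 1" by (metis dvdE diff_add_cancel)
  with \<open>p > 1\<close> obtain m where p: "p = int (4 * m + 1)"
    using that[of "nat k"] by auto
  have "half_fact p = fact (2 * m)" by (simp add: half_fact_eq_fact p nat_mult_distrib)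
  then have "[fact (4 * m) = (half_fact p)\<^sup>2] (mod p)"
    using fact_pred_cong_fact_mult_fact[of "2 * m" "4 * m + 1"]
    by (simp add: p power2_eq_square)
  moreover have "prime (4 * m + 1)" using assms(1) unfolding p prime_nat_int_transfer .
  then have "[fact (4 * m) = - 1] (mod p)" using wilson_theorem[of "4 * m + 1"] by (simp add: p)
  ultimately show ?thesis using cong_sym cong_trans by blast
qed

theorem theorem2p4:
  fixes p :: int
  assumes "prime p" and "[p = 1] (mod 4)"
  shows "(\<forall>a\<in>V p. bar p a - a \<in> V p \<and> bar p (bar p a - a) = fold_res p (bar p a + a))
       \<and> {bar p a - a | a. a \<in> V p} = V p
       \<and> {fold_res p (bar p a + a) | a. a \<in> V p} = {1..(p - 1) div 2} - V p"
proof -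
  have "odd p" using assms(2) by (auto simp: cong_def) presburger
  then interpret sqrt_minus_one p "half_fact p"
    using half_fact_square_cong[OF assms] by unfold_locales
  have bar: "bar p = quarter_turn"
    by (simp add: fun_eq_iff bar_def quarter_turn_def)
  have V: "V p = orbit_minima"
    by (auto simp: V_def orbit_minima_def half_residues_def quarter_turn_def)
  show ?thesis
    unfolding bar V Setcompr_eq_image half_residues_def[symmetric]
    by (simp add: diff_mem_orbit_minima quarter_turn_diff diff_image_orbit_minima
        sum_image_orbit_minima)
qed

end
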